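(* Let $(M,d)$ be a complete metric space with base point $0$ and let $\mu\in\mathcal{M}_{\mathrm{op}}(\beta\widetilde{M})$. Then there exists a $\mu$-null set $N\subset\mathrm{supp}(\mu)\setminus\widetilde{M}$ such that, if we set $C=\mathsf{R}\cap\mathrm{supp}(\mu)\setminus N$, then $\mathfrak{p}(C)$ is $\bar{d}$-cyclically monotonic and $\bar{d}\circ\mathfrak{p}|_C=d|_C$.
   Context: Basic spaces. $(M,d)$ is a complete metric space with base point $0\in M$. $\mathrm{Lip}_0(M)$ is the Banach space of real-valued Lipschitz functions $f$ on $M$ with $f(0)=0$, normed by the optimal Lipschitz constant. $\widetilde{M}=\{(x,y)\in M\times M: x\neq y\}$ and $\beta\widetilde{M}$ is its Stone-Čech compactification. $\mathcal{M}(\beta\widetilde{M})$ is the Banach space (total variation norm) of signed (finite) Radon measures on $\beta\widetilde{M}$. $\mathrm{supp}(\mu)$ is the closed set of points all of whose open neighbourhoods have positive $|\mu|$-measure. $\Phi:\mathrm{Lip}_0(M)\to C(\beta\widetilde{M})$ is given by $(\Phi f)(x,y)=\frac{f(x)-f(y)}{d(x,y)}$ on $\widetilde{M}$, extended continuously to $\beta\widetilde{M}$; $\Phi^*:\mathcal{M}(\beta\widetilde{M})\to\mathrm{Lip}_0(M)^*$ is its adjoint. $\mathcal{M}_{\mathrm{op}}(\beta\widetilde{M})=\{\mu\in\mathcal{M}(\beta\widetilde{M}):\mu\geq 0,\ \|\mu\|=\|\Phi^*\mu\|\}$. Compactifications. $M^{\mathcal{U}}$ is the uniform (Samuel) compactification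 of $M$: the unique compactification to which every bounded uniformly continuous $f:M\to\mathbb{R}$ extends continuously and in which the closures of $A,B\subset M$ are disjoint iff $d(A,B)>0$. Every Lipschitz $f:M\to\mathbb{R}$ extends uniquely and continuously to $f^{\mathcal{U}}:M^{\mathcal{U}}\to[-\infty,\infty]$. With $\rho(x)=d(x,0)$, let $M^{\mathcal{R}}=\{\xi\in M^{\mathcal{U}}:\rho^{\mathcal{U}}(\xi)<\infty\}$ and $f^{\mathcal{R}}=f^{\mathcal{U}}|_{M^{\mathcal{R}}}$ (real-valued). For $\xi\in M^{\mathcal{R}}$, $\delta(\xi)\in\mathrm{Lip}_0(M)^*$ is $\langle f,\delta(\xi)\rangle=f^{\mathcal{R}}(\xi)$, and $\bar{d}(\xi,\eta)=\|\delta(\xi)-\delta(\eta)\|_{\mathrm{Lip}_0(M)^*}$, a metric on $M^{\mathcal{R}}$ extending $d$. Coordinates. $\mathfrak{p}_i:\beta\widetilde{M}\to M^{\mathcal{U}}$ ($i=1,2$) is the continuous extension of the $i$-th coordinate projection on $\widetilde{M}$, and $\mathfrak{p}=(\mathfrak{p}_1,\mathfrak{p}_2)$. $\mathsf{R}=\mathfrak{p}^{-1}(M^{\mathcal{R}}\times M^{\mathcal{R}})\subset\beta\widetilde{M}$. The symbol $d$ also denotes the continuous extension of $d:\widetilde{M}\to\mathbb{R}$ to $\beta\widetilde{M}\to[0,\infty]$. A set $D\subset M^{\mathcal{R}}\times M^{\mathcal{R}}$ is $\bar{d}$-cyclically monotonic if for all $(\xi_1,\eta_1),\dots,(\xi_n,\eta_n)\in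 D$ and every permutation $\sigma$ of $\{1,\dots,n\}$, $\sum_{k=1}^n\bar{d}(\xi_k,\eta_k)\leq\sum_{k=1}^n\bar{d}(\xi_k,\eta_{\sigma(k)})$. *)

theory Defs
  imports "HOL-Analysis.Analysis"
begin

section \<open>Compactifications\<close>

definition compactification :: "'c topology \<Rightarrow> 'k topology \<Rightarrow> ('c \<Rightarrow> 'k) \<Rightarrow> bool" where
  "compactification X K e \<longleftrightarrow>
     compact_space K \<and> Hausdorff_space K \<and> embedding_map X K e \<and>
     K closure_of (e ` topspace X) = topspace K"

definition extends_along ::
    "'c set \<Rightarrow> 'k topology \<Rightarrow> ('c \<Rightarrow> 'k) \<Rightarrow> 't topology \<Rightarrow> ('c \<Rightarrow> 't) \<Rightarrow> ('k \<Rightarrow> 't) \<Rightarrow> bool" where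
  "extends_along S K e T f g \<longleftrightarrow> continuous_map K T g \<and> (\<forall>x\<in>S. g (e x) = f x)"

text \<open>If \<open>e ` S\<close> is dense in \<open>K\<close> and \<open>T\<close> is Hausdorff, the extension is unique on
  \<open>topspace K\<close>; the choice operator only leaves its values outside \<open>topspace K\<close> open.\<close>

definition cont_ext ::
    "'c set \<Rightarrow> 'k topology \<Rightarrow> ('c \<Rightarrow> 'k) \<Rightarrow> 't topology \<Rightarrow> ('c \<Rightarrow> 't) \<Rightarrow> 'k \<Rightarrow> 't" where
  "cont_ext S K e T f = (SOME g. extends_along S K e T f g)"

definition stone_cech_compactification :: "'c topology \<Rightarrow> 'k topology \<Rightarrow> ('c \<Rightarrow> 'k) \<Rightarrow> bool" where
  "stone_cech_compactification X K e \<longleftrightarrow>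
     compactification X K e \<and>
     (\<forall>f. continuous_map X euclideanreal f \<and> bounded (f ` topspace X) \<longrightarrow>
        (\<exists>g. extends_along (topspace X) K e euclideanreal f g))"

text \<open>The distance of two sets is taken in the extended reals, so that it is \<open>\<infinity>\<close> when
  one of them is empty (the library's \<open>setdist\<close> would give \<open>0\<close>).\<close>

definition uniform_compactification :: "'u topology \<Rightarrow> ('a::metric_space \<Rightarrow> 'u) \<Rightarrow> bool" where
  "uniform_compactification U u \<longleftrightarrow>
     compactification euclidean U u \<and>
     (\<forall>f :: 'a \<Rightarrow> real. uniformly_continuous_on UNIV f \<and> bounded (range f) \<longrightarrow>
        (\<exists>g. extends_along UNIV U u euclideanreal f g)) \<and>
     (\<forall>A B. U closure_of (u ` A) \<inter> U closure_of (u ` B) = {} \<longleftrightarrow>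
        (INF (a, b) \<in> A \<times> B. ereal (dist a b)) > 0)"


section \<open>Lipschitz functions and functionals on them\<close>

definition Lip0 :: "'a::metric_space \<Rightarrow> ('a \<Rightarrow> real) set" where
  "Lip0 z = {f. (\<exists>L. L-lipschitz_on UNIV f) \<and> f z = 0}"

definition lip_norm :: "('a::metric_space \<Rightarrow> real) \<Rightarrow> real" where
  "lip_norm f = Inf {L. L-lipschitz_on UNIV f}"

definition Lip0_dual_norm :: "'a::metric_space \<Rightarrow> (('a \<Rightarrow> real) \<Rightarrow> real) \<Rightarrow> real" where
  "Lip0_dual_norm z \<phi> = (SUP f \<in> {f \<in> Lip0 z. lip_norm f \<le> 1}. \<bar>\<phi> f\<bar>)"


section \<open>The space \<open>M\<^sup>\<R>\<close> and its metric\<close>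

text \<open>Below, \<open>z\<close> is the base point of \<open>M\<close>, the complete metric space formed by the type
  \<open>'a\<close>; \<open>(U, u)\<close> is its uniform compactification and \<open>(B, b)\<close> is the Stone--Cech
  compactification of the space \<open>Mtilde\<close> of pairs of distinct points.\<close>

definition U_ext :: "'u topology \<Rightarrow> ('a::metric_space \<Rightarrow> 'u) \<Rightarrow> ('a \<Rightarrow> real) \<Rightarrow> 'u \<Rightarrow> ereal" where
  "U_ext U u f = cont_ext UNIV U u euclidean (\<lambda>x. ereal (f x))"

definition MR :: "'u topology \<Rightarrow> ('a::metric_space \<Rightarrow> 'u) \<Rightarrow> 'a \<Rightarrow> 'u set" where
  "MR U u z = {\<xi> \<in> topspace U. U_ext U u (\<lambda>x. dist x z) \<xi> < \<infinity>}"

definition delta :: "'u topology \<Rightarrow> ('a::metric_space \<Rightarrow> 'u) \<Rightarrow> 'u \<Rightarrow> ('a \<Rightarrow> real) \<Rightarrow> real" where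
  "delta U u \<xi> f = real_of_ereal (U_ext U u f \<xi>)"

definition dbar :: "'u topology \<Rightarrow> ('a::metric_space \<Rightarrow> 'u) \<Rightarrow> 'a \<Rightarrow> 'u \<Rightarrow> 'u \<Rightarrow> real" where
  "dbar U u z \<xi> \<eta> = Lip0_dual_norm z (\<lambda>f. delta U u \<xi> f - delta U u \<eta> f)"

definition dbar_cyclically_monotonic ::
    "'u topology \<Rightarrow> ('a::metric_space \<Rightarrow> 'u) \<Rightarrow> 'a \<Rightarrow> ('u \<times> 'u) set \<Rightarrow> bool" where
  "dbar_cyclically_monotonic U u z D \<longleftrightarrow>
     D \<subseteq> MR U u z \<times> MR U u z \<and>
     (\<forall>(n::nat) \<xi> \<eta> \<sigma>. (\<forall>k\<in>{1..n}. (\<xi> k, \<eta> k) \<in> D) \<and> \<sigma> permutes {1..n} \<longrightarrow>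
        (\<Sum>k=1..n. dbar U u z (\<xi> k) (\<eta> k)) \<le> (\<Sum>k=1..n. dbar U u z (\<xi> k) (\<eta> (\<sigma> k))))"


section \<open>The Stone--Cech compactification of \<open>Mtilde\<close>\<close>

definition Mtilde :: "('a \<times> 'a) set" where
  "Mtilde = {(x, y). x \<noteq> y}"

definition Phi ::
    "'b topology \<Rightarrow> ('a::metric_space \<times> 'a \<Rightarrow> 'b) \<Rightarrow> ('a \<Rightarrow> real) \<Rightarrow> 'b \<Rightarrow> real" where
  "Phi B b f = cont_ext Mtilde B b euclideanreal (\<lambda>(x, y). (f x - f y) / dist x y)"

definition d_ext :: "'b topology \<Rightarrow> ('a::metric_space \<times> 'a \<Rightarrow> 'b) \<Rightarrow> 'b \<Rightarrow> ereal" where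
  "d_ext B b = cont_ext Mtilde B b euclidean (\<lambda>(x, y). ereal (dist x y))"

definition coord ::
    "'b topology \<Rightarrow> ('a \<times> 'a \<Rightarrow> 'b) \<Rightarrow> 'u topology \<Rightarrow> ('a \<Rightarrow> 'u) \<Rightarrow> 'b \<Rightarrow> 'u \<times> 'u" where
  "coord B b U u \<zeta> =
     (cont_ext Mtilde B b U (\<lambda>p. u (fst p)) \<zeta>, cont_ext Mtilde B b U (\<lambda>p. u (snd p)) \<zeta>)"

definition Rset ::
    "'b topology \<Rightarrow> ('a::metric_space \<times> 'a \<Rightarrow> 'b) \<Rightarrow> 'u topology \<Rightarrow> ('a \<Rightarrow> 'u) \<Rightarrow> 'a \<Rightarrow> 'b set" where
  "Rset B b U u z = {\<zeta> \<in> topspace B. coord B b U u \<zeta> \<in> MR U u z \<times> MR U u z}"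


section \<open>Measures\<close>

text \<open>Finite positive Radon measures on \<open>K\<close>.\<close>

definition radon_measure :: "'k topology \<Rightarrow> 'k measure \<Rightarrow> bool" where
  "radon_measure K \<mu> \<longleftrightarrow>
     finite_measure \<mu> \<and> space \<mu> = topspace K \<and>
     sets \<mu> = sigma_sets (topspace K) {V. openin K V} \<and>
     (\<forall>A\<in>sets \<mu>. emeasure \<mu> A = (SUP C \<in> {C \<in> sets \<mu>. compactin K C \<and> C \<subseteq> A}. emeasure \<mu> C))"

definition supp :: "'k topology \<Rightarrow> 'k measure \<Rightarrow> 'k set" where
  "supp K \<mu> = {\<zeta> \<in> topspace K. \<forall>V. openin K V \<and> \<zeta> \<in> V \<longrightarrow> emeasure \<mu> V > 0}"

text \<open>Only positive measures occur, so they are library measures; for these the total variation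
  norm is the total mass.\<close>

definition Phi_adjoint ::
    "'b topology \<Rightarrow> ('a::metric_space \<times> 'a \<Rightarrow> 'b) \<Rightarrow> 'b measure \<Rightarrow> ('a \<Rightarrow> real) \<Rightarrow> real" where
  "Phi_adjoint B b \<mu> f = (\<integral>\<zeta>. Phi B b f \<zeta> \<partial>\<mu>)"

definition M_op :: "'b topology \<Rightarrow> ('a::metric_space \<times> 'a \<Rightarrow> 'b) \<Rightarrow> 'a \<Rightarrow> 'b measure set" where
  "M_op B b z =
     {\<mu>. radon_measure B \<mu> \<and> measure \<mu> (space \<mu>) = Lip0_dual_norm z (Phi_adjoint B b \<mu>)}"

end

theory Submission
  imports Defs
begin

text \<open>
  Since \<open>\<mu>\<close> is positive and \<open>\<bar>\<Phi> f\<bar> \<le> 1\<close> for \<open>f\<close> in the unit ball, a sequence \<open>f\<^sub>n\<close> in the unit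
  ball that almost attains \<open>\<parallel>\<Phi>\<^sup>* \<mu>\<parallel> = \<parallel>\<mu>\<parallel>\<close> satisfies \<open>\<integral> (1 - \<Phi> f\<^sub>n) d\<mu> \<rightarrow> 0\<close>, so \<open>\<Phi> f\<^sub>n \<rightarrow> 1\<close>
  \<open>\<mu>\<close>-almost everywhere along a subsequence; \<open>N\<close> is the part of the support where this fails.
  By density of the pairs of distinct points, \<open>f(\<xi>) - f(\<eta>) = \<Phi> f(\<zeta>) d(\<zeta>)\<close> for every \<open>\<zeta>\<close> in
  \<open>R\<close> with coordinates \<open>(\<xi>, \<eta>)\<close>. Hence \<open>f\<^sub>n(\<xi>) - f\<^sub>n(\<eta>)\<close> tends to \<open>d(\<zeta>)\<close> off \<open>N\<close>, which is the largest
  value that unit ball functions allow, and the \<open>f\<^sub>n\<close> act as approximate Kantorovich potentials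
  for all of \<open>C\<close> simultaneously. A point \<open>(x, y)\<close> of the support with \<open>x \<noteq> y\<close> in \<open>M\<close> cannot lie in \<open>N\<close>: its
  neighbourhoods have positive measure and so contain points where \<open>\<Phi> f\<^sub>n \<rightarrow> 1\<close>, and
  the Lipschitz condition transfers this to \<open>(x, y)\<close>.
\<close>

section \<open>Extensions to compactifications\<close>

text \<open>If \<open>g\<close> left \<open>C\<close> at \<open>\<zeta>\<close>, the points of
  \<open>V\<close> that \<open>g\<close> sends outside \<open>C\<close> would form a nonempty open
  set, and this would meet the dense set. Working inside \<open>V\<close> allows estimates that hold
  only near \<open>\<zeta>\<close>.\<close>

lemma dense_closedin:
  assumes g: "continuous_map K T g" and dense: "K closure_of (e ` S) = topspace K"
    and V: "openin K V" "\<zeta> \<in> V" and C: "closedin T C"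
    and sub: "\<And>x. x \<in> S \<Longrightarrow> e x \<in> V \<Longrightarrow> g (e x) \<in> C"
  shows "g \<zeta> \<in> C"
proof (rule ccontr)
  assume "g \<zeta> \<notin> C"
  define W where "W = V \<inter> {x \<in> topspace K. g x \<in> topspace T - C}"
  have "openin K W"
    unfolding W_def using V C by (intro openin_Int openin_continuous_map_preimage[OF g]) auto
  moreover have "\<zeta> \<in> W" "\<zeta> \<in> topspace K"
    using V \<open>g \<zeta> \<notin> C\<close> g openin_subset[OF V(1)] continuous_map_funspace[OF g]
    by (auto simp: W_def)
  moreover from this have "\<zeta> \<in> K closure_of (e ` S)" unfolding dense by blast
  ultimately obtain y where "y \<in> e ` S" "y \<in> W"
    unfolding in_closure_of by blast
  then show False using sub by (auto simp: W_def)
qed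

lemma continuous_map_if_embedding_map: "embedding_map X Y f \<Longrightarrow> continuous_map X Y f"
  unfolding embedding_map_def
  by (rule continuous_map_into_fulltopology[OF homeomorphic_imp_continuous_map])

lemma extends_along_cont_ext:
  "extends_along S K e T f g \<Longrightarrow> extends_along S K e T f (cont_ext S K e T f)"
  unfolding cont_ext_def by (rule someI[of "extends_along S K e T f"])

text \<open>Bounded extension properties yield \<open>[-\<infinity>, \<infinity>]\<close>-valued extensions of unbounded functions by
  compressing the line to \<open>(-1, 1)\<close> and undoing this after extending.\<close>

definition squash :: "real \<Rightarrow> real" where
  "squash t = t / (1 + \<bar>t\<bar>)"

text \<open>The constant values beyond -1 and 1 make this a total monotone map, so it applies to any
  real-valued extension of a squashed function.\<close>

definition unsquash :: "real \<Rightarrow> ereal" where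
  "unsquash s = (if s \<le> -1 then -\<infinity> else if s \<ge> 1 then \<infinity> else ereal (s / (1 - \<bar>s\<bar>)))"

lemma abs_squash_less: "\<bar>squash t\<bar> < 1"
  unfolding squash_def by (simp add: abs_divide)
lemma one_minus_abs_squash: "1 - \<bar>squash t\<bar> = 1 / (1 + \<bar>t\<bar>)"
proof -
  have "1 + \<bar>t\<bar> > 0" by simp
  then show ?thesis by (simp add: squash_def abs_divide field_simps)
qed

lemma unsquash_squash: "unsquash (squash t) = ereal t"
proof -
  have "squash t / (1 - \<bar>squash t\<bar>) = t"
    using abs_ge_zero[of t] unfolding one_minus_abs_squash by (simp add: squash_def add_nonneg_eq_0_iff)
  with abs_squash_less[of t] show ?thesis
    unfolding unsquash_def
    by (subst if_not_P, linarith, subst if_not_P, linarith) (rule arg_cong)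
qed

text \<open>This makes \<open>squash\<close> of a Lipschitz function uniformly continuous. Over the
  common denominator \<open>D\<close> the numerator is at most
  \<open>\<bar>a - b\<bar> * (1 + \<bar>a\<bar> + \<bar>b\<bar>)\<close>, which is below
  \<open>\<bar>a - b\<bar> * D\<close>.\<close>

lemma squash_contraction: "\<bar>squash a - squash b\<bar> \<le> \<bar>a - b\<bar>"
proof -
  define D where "D = (1 + \<bar>a\<bar>) * (1 + \<bar>b\<bar>)"
  have pos: "1 + \<bar>a\<bar> > 0" "1 + \<bar>b\<bar> > 0" by auto
  then have "D > 0" unfolding D_def by (rule mult_pos_pos)
  have *: "\<bar>s * \<bar>t\<bar> - t * \<bar>s\<bar>\<bar> \<le> 2 * (\<bar>t\<bar> * \<bar>s - t\<bar>)" for s t :: real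
  proof -
    have eq: "s * \<bar>t\<bar> - t * \<bar>s\<bar> = (s - t) * \<bar>t\<bar> + t * (\<bar>t\<bar> - \<bar>s\<bar>)"
      by (simp add: algebra_simps)
    have "\<bar>s * \<bar>t\<bar> - t * \<bar>s\<bar>\<bar> \<le> \<bar>(s - t) * \<bar>t\<bar>\<bar> + \<bar>t * (\<bar>t\<bar> - \<bar>s\<bar>)\<bar>"
      unfolding eq by (rule abs_triangle_ineq)
    also have "\<dots> = \<bar>t\<bar> * \<bar>s - t\<bar> + \<bar>t\<bar> * \<bar>\<bar>t\<bar> - \<bar>s\<bar>\<bar>"
      by (simp add: abs_mult)
    also have "\<bar>t\<bar> * \<bar>\<bar>t\<bar> - \<bar>s\<bar>\<bar> \<le> \<bar>t\<bar> * \<bar>s - t\<bar>" by (intro mult_left_mono) auto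
    finally show ?thesis by simp
  qed
  have "squash a - squash b = (a * (1 + \<bar>b\<bar>) - b * (1 + \<bar>a\<bar>)) / D"
    using pos unfolding squash_def D_def by (subst diff_frac_eq) auto
  moreover have "a * (1 + \<bar>b\<bar>) - b * (1 + \<bar>a\<bar>) = (a - b) + (a * \<bar>b\<bar> - b * \<bar>a\<bar>)"
    by (simp add: algebra_simps)
  ultimately have eq: "\<bar>squash a - squash b\<bar> = \<bar>(a - b) + (a * \<bar>b\<bar> - b * \<bar>a\<bar>)\<bar> / D"
    using abs_divide abs_of_pos[OF \<open>D > 0\<close>] by metis
  \<comment> \<open>The left side is symmetric in \<open>a\<close> and \<open>b\<close>, so the two
    instances of \<open>*\<close> can be averaged; this removes the factor 2.\<close>
  have "\<bar>a * \<bar>b\<bar> - b * \<bar>a\<bar>\<bar> \<le> \<bar>a\<bar> * \<bar>a - b\<bar> + \<bar>b\<bar> * \<bar>a - b\<bar>"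
    using *[of a b] *[of b a] by (simp add: abs_minus_commute)
  then have "\<bar>(a - b) + (a * \<bar>b\<bar> - b * \<bar>a\<bar>)\<bar> \<le> \<bar>a - b\<bar> + \<bar>a\<bar> * \<bar>a - b\<bar> + \<bar>b\<bar> * \<bar>a - b\<bar>"
    by linarith
  also have "\<dots> \<le> \<bar>a - b\<bar> + \<bar>a\<bar> * \<bar>a - b\<bar> + \<bar>b\<bar> * \<bar>a - b\<bar> + \<bar>a\<bar> * \<bar>b\<bar> * \<bar>a - b\<bar>" by simp
  also have "\<dots> = \<bar>a - b\<bar> * D" unfolding D_def by (simp add: algebra_simps)
  finally show ?thesis unfolding eq using \<open>D > 0\<close> by (simp add: pos_divide_le_eq)
qed

lemma continuous_on_squash: "continuous_on A squash"
  unfolding squash_def by (intro continuous_intros) auto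

text \<open>A monotone map with open range is continuous, and the range here is everything; no
  limits at -1 and 1 have to be computed.\<close>

lemma continuous_on_unsquash: "continuous_on UNIV unsquash"
proof (rule continuous_onI_mono)
  have "y \<in> range unsquash" for y
  proof (cases y)
    case (real r) then show ?thesis by (metis unsquash_squash rangeI)
  next
    case PInf
    then have "y = unsquash 1" by (simp add: unsquash_def)
    then show ?thesis by blast
  next
    case MInf
    then have "y = unsquash (-1)" by (simp add: unsquash_def)
    then show ?thesis by blast
  qed
  then show "open (range unsquash)" by (metis open_UNIV UNIV_eq_I)
next
  fix x y :: real assume "x \<le> y"
  have "x / (1 - \<bar>x\<bar>) \<le> y / (1 - \<bar>y\<bar>)" if "-1 < x" "y < 1"
  proof -
    consider "0 \<le> x" | "y \<le> 0" | "x \<le> 0" "0 \<le> y" by linarith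
    then show ?thesis
    proof cases
      case 3
      then have "x / (1 - \<bar>x\<bar>) \<le> 0" "0 \<le> y / (1 - \<bar>y\<bar>)"
        using that by (auto simp: divide_simps)
      then show ?thesis by linarith
    qed (use \<open>x \<le> y\<close> that in \<open>auto simp: field_simps\<close>)
  qed
  then show "unsquash x \<le> unsquash y"
    using \<open>x \<le> y\<close> by (auto simp: unsquash_def)
qed

lemma extends_along_ereal:
  assumes "extends_along S K e euclideanreal (\<lambda>x. squash (f x)) g"
  shows "extends_along S K e euclidean (\<lambda>x. ereal (f x)) (\<lambda>y. unsquash (g y))"
proof -
  have "continuous_map K euclidean (unsquash \<circ> g)"
    using assms continuous_on_unsquash unfolding extends_along_def
    by (intro continuous_map_compose[of K euclideanreal]) auto
  then show ?thesis
    using assms by (simp add: extends_along_def unsquash_squash o_def)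
qed

text \<open>Real-valued extensions suffice for all compact Hausdorff targets: embed \<open>T\<close>
  in a cube, extend every coordinate, and pull the assembled map back through the inverse of the
  embedding.\<close>

lemma extends_along_compact:
  assumes X: "compactification X K e"
    and ext: "\<And>f. continuous_map X euclideanreal f \<Longrightarrow> bounded (f ` topspace X) \<Longrightarrow>
        \<exists>g. extends_along (topspace X) K e euclideanreal f g"
    and T: "compact_space T" "Hausdorff_space T" and f: "continuous_map X T f"
  shows "\<exists>g. extends_along (topspace X) K e T f g"
proof -
  have "completely_regular_space T"
    using T compact_Hausdorff_or_regular_imp_normal_space normal_imp_completely_regular_space
    by blast
  then obtain I :: "('c \<Rightarrow> real) set" and i
    where i: "embedding_map T (product_topology (\<lambda>_. top_of_set {0..1::real}) I) i"
    using completely_regular_space_cube_embedding T by metis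
  define Q where "Q = product_topology (\<lambda>_. top_of_set {0..1::real}) I"
  \<comment> \<open>The extended coordinates are only known to be real-valued, so they are assembled
    in a product of lines; that they stay in the cube follows from density.\<close>
  define P where "P = product_topology (\<lambda>_::'c \<Rightarrow> real. euclideanreal) I"
  obtain i' where hom: "homeomorphic_maps T (subtopology Q (i ` topspace T)) i i'"
    using i by (force simp: Q_def embedding_map_def homeomorphic_map_maps)
  have i_cont: "continuous_map T Q i"
    and i'_cont: "continuous_map (subtopology Q (i ` topspace T)) T i'"
    and i'i: "\<And>x. x \<in> topspace T \<Longrightarrow> i' (i x) = x"
    using hom by (auto simp: homeomorphic_maps_def continuous_map_in_subtopology)
  have Q_P: "Q = subtopology P (PiE I (\<lambda>_. {0..1}))"
    unfolding Q_def P_def by (simp add: subtopology_product_topology)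
  have i_contP: "continuous_map T P i"
    using i_cont by (simp add: Q_P continuous_map_in_subtopology)
  have imi: "i ` topspace T \<subseteq> PiE I (\<lambda>_. {0..1})"
    using i_cont unfolding Q_P continuous_map_in_subtopology by auto
  have "\<exists>g. extends_along (topspace X) K e euclideanreal (\<lambda>x. i (f x) k) g" if "k \<in> I" for k
  proof (rule ext)
    have "continuous_map P euclideanreal (\<lambda>y. y k)"
      unfolding P_def using that by (rule continuous_map_product_projection)
    then show "continuous_map X euclideanreal (\<lambda>x. i (f x) k)"
      using continuous_map_compose[OF continuous_map_compose[OF f i_contP]] by (simp add: o_def)
    have "i (f x) k \<in> {0..1}" if "x \<in> topspace X" for x
      using imi continuous_map_funspace[OF f] that \<open>k \<in> I\<close> by fast
    then have "(\<lambda>x. i (f x) k) ` topspace X \<subseteq> {0..1}" by blast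
    then show "bounded ((\<lambda>x. i (f x) k) ` topspace X)"
      using bounded_closed_interval bounded_subset by blast
  qed
  then obtain G where G: "\<And>k. k \<in> I \<Longrightarrow> extends_along (topspace X) K e euclideanreal (\<lambda>x. i (f x) k) (G k)"
    by metis
  \<comment> \<open>Points of a product topology are extensional functions, hence the restriction to
    \<open>I\<close>.\<close>
  define h where "h y = restrict (\<lambda>k. G k y) I" for y
  have h_cont: "continuous_map K P h"
    using G unfolding P_def by (auto simp: continuous_map_componentwise h_def extends_along_def)
  have h_e: "h (e x) = i (f x)" if "x \<in> topspace X" for x
  proof -
    have "i (f x) \<in> extensional I"
      using imi continuous_map_funspace[OF f] that by (fastforce simp: PiE_def)
    then show ?thesis using G that by (auto simp: h_def extends_along_def extensional_def)
  qed
  \<comment> \<open>The image of \<open>T\<close> is compact in a Hausdorff space; being closed, it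
    contains the values of \<open>h\<close> on all of \<open>K\<close> once it contains those on the
    dense set.\<close>
  have "closedin P (i ` topspace T)"
    using T i_contP unfolding P_def
    by (metis Hausdorff_space_euclidean Hausdorff_space_product_topology compactin_imp_closedin
        compact_space_def image_compactin)
  then have h_in: "h y \<in> i ` topspace T" if "y \<in> topspace K" for y
    using dense_closedin[OF h_cont, of e "topspace X" "topspace K" y] X that h_e
      continuous_map_funspace[OF f]
    by (fastforce simp: compactification_def)
  have "continuous_map K (subtopology Q (i ` topspace T)) h"
    using h_cont h_in imi unfolding Q_P subtopology_subtopology
    by (auto simp: continuous_map_in_subtopology)
  then have "continuous_map K T (\<lambda>y. i' (h y))"
    using continuous_map_compose[OF _ i'_cont] by (simp add: o_def)
  moreover have "i' (h (e x)) = f x" if "x \<in> topspace X" for x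
    using h_e[OF that] i'i continuous_map_funspace[OF f] that by auto
  ultimately show ?thesis unfolding extends_along_def by blast
qed

lemma continuous_map_real_of_ereal:
  assumes "continuous_map X euclidean F" "\<And>x. x \<in> topspace X \<Longrightarrow> \<bar>F x :: ereal\<bar> \<noteq> \<infinity>"
  shows "continuous_map X euclideanreal (\<lambda>x. real_of_ereal (F x))"
proof -
  have "continuous_map X (top_of_set (UNIV - {\<infinity>, -\<infinity>})) F"
    using assms by (fastforce simp: continuous_map_in_subtopology)
  moreover have "continuous_map (top_of_set (UNIV - {\<infinity>, -\<infinity>})) euclideanreal real_of_ereal"
    using continuous_on_real by simp
  ultimately have "continuous_map X euclideanreal (real_of_ereal \<circ> F)"
    by (rule continuous_map_compose)
  then show ?thesis by (simp add: o_def)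
qed

section \<open>The unit ball of Lipschitz functions\<close>

text \<open>Lipschitz constants arbitrarily close to the infimum are enough, since the inequality
  for fixed \<open>x\<close> and \<open>y\<close> is closed.\<close>

lemma lipschitz_1_if_lip_norm_le_1:
  assumes "f \<in> Lip0 z" "lip_norm f \<le> 1"
  shows "1-lipschitz_on UNIV f"
proof (rule lipschitz_onI)
  fix x y
  have ne: "{L. L-lipschitz_on UNIV f} \<noteq> {}" using assms by (auto simp: Lip0_def)
  show "dist (f x) (f y) \<le> 1 * dist x y"
  proof (rule field_le_epsilon)
    fix e :: real assume "0 < e"
    \<comment> \<open>Scaled so that the excess \<open>c * dist x y\<close> is at most
      \<open>e\<close>; the summand 1 covers \<open>x = y\<close>.\<close>
    define c where "c = e / (1 + dist x y)"
    have c: "0 < c" "c * dist x y \<le> e" using \<open>0 < e\<close>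
      by (auto simp: c_def divide_simps add_pos_nonneg)
    have "Inf {L. L-lipschitz_on UNIV f} < 1 + c"
      using assms c by (simp add: lip_norm_def)
    then obtain L where L: "L-lipschitz_on UNIV f" "L < 1 + c"
      using cInf_lessD[OF ne] by auto
    have "dist (f x) (f y) \<le> L * dist x y" using lipschitz_onD[OF L(1)] by simp
    also have "\<dots> \<le> (1 + c) * dist x y" using L(2) by (intro mult_right_mono) auto
    finally show "dist (f x) (f y) \<le> 1 * dist x y + e" using c by (simp add: algebra_simps)
  qed
qed auto

lemma lip_norm_le:
  assumes "L-lipschitz_on UNIV f"
  shows "lip_norm f \<le> L"
  unfolding lip_norm_def
  by (rule cInf_lower) (use assms lipschitz_on_nonneg in \<open>auto intro!: bdd_belowI[of _ 0]\<close>)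

definition lip_ball :: "'a::metric_space \<Rightarrow> ('a \<Rightarrow> real) set" where
  "lip_ball z = {f \<in> Lip0 z. lip_norm f \<le> 1}"

lemma lip_ball_iff: "f \<in> lip_ball z \<longleftrightarrow> 1-lipschitz_on UNIV f \<and> f z = 0"
  using lipschitz_1_if_lip_norm_le_1 lip_norm_le by (auto simp: lip_ball_def Lip0_def)

lemma lip_ball_uminus: "f \<in> lip_ball z \<Longrightarrow> (\<lambda>x. - f x) \<in> lip_ball z"
  by (auto simp: lip_ball_iff lipschitz_on_def dist_minus)

lemma lip_ball_diff_le: "f \<in> lip_ball z \<Longrightarrow> \<bar>f x - f y\<bar> \<le> dist x y"
  using lipschitz_onD[of 1 UNIV f x y] by (auto simp: lip_ball_iff dist_real_def)

lemma zero_in_lip_ball: "(\<lambda>_. 0) \<in> lip_ball z"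
  by (auto simp: lip_ball_iff lipschitz_on_def)

lemma lipschitz_on_dist: "1-lipschitz_on UNIV (\<lambda>x. dist x (z::'a::metric_space))"
  by (rule lipschitz_onI) (use abs_dist_diff_le[of _ z] in \<open>auto simp: dist_real_def dist_commute\<close>)

section \<open>The space \<open>M\<^sup>\<R>\<close>\<close>

context
  fixes z :: "'a::metric_space"
    and U :: "'u topology" and u :: "'a \<Rightarrow> 'u"
  assumes uc: "uniform_compactification U u"
begin

lemma uniform_compactification_facts:
  shows U_compact: "compact_space U" "Hausdorff_space U"
    and u_continuous: "continuous_map euclidean U u"
    and u_dense: "U closure_of range u = topspace U"
  using uc continuous_map_if_embedding_map[of euclidean U u]
  by (simp_all add: uniform_compactification_def compactification_def)

lemma U_ext_extends:
  assumes "L-lipschitz_on UNIV f"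
  shows "extends_along UNIV U u euclidean (\<lambda>x. ereal (f x)) (U_ext U u f)"
proof -
  have "uniformly_continuous_on UNIV (\<lambda>x. squash (f x))"
    unfolding uniformly_continuous_on_def
  proof (intro allI impI)
    fix e :: real assume "0 < e"
    obtain d where "d > 0" "\<And>x y. dist y x < d \<Longrightarrow> dist (f y) (f x) < e"
      using lipschitz_on_uniformly_continuous[OF assms] \<open>0 < e\<close>
      unfolding uniformly_continuous_on_def by blast
    moreover have "dist (squash (f x)) (squash (f y)) \<le> dist (f x) (f y)" for x y
      unfolding dist_real_def by (rule squash_contraction)
    ultimately show "\<exists>d>0. \<forall>x\<in>UNIV. \<forall>x'\<in>UNIV. dist x' x < d \<longrightarrow> dist (squash (f x')) (squash (f x)) < e"
      by (metis order.strict_trans1)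
  qed
  moreover have "bounded (range (\<lambda>x. squash (f x)))"
    by (rule boundedI[of _ 1]) (use abs_squash_less[THEN less_imp_le] in auto)
  ultimately obtain g where "extends_along UNIV U u euclideanreal (\<lambda>x. squash (f x)) g"
    using uc unfolding uniform_compactification_def by blast
  from extends_along_ereal[OF this] show ?thesis
    unfolding U_ext_def by (rule extends_along_cont_ext)
qed

lemma U_ext_continuous: "L-lipschitz_on UNIV f \<Longrightarrow> continuous_map U euclidean (U_ext U u f)"
  and U_ext_image: "L-lipschitz_on UNIV f \<Longrightarrow> U_ext U u f (u x) = ereal (f x)"
  using U_ext_extends unfolding extends_along_def by blast+

lemma u_in_MR: "u x \<in> MR U u z"
  using continuous_map_funspace[OF u_continuous]
  by (auto simp: MR_def U_ext_image[OF lipschitz_on_dist])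

lemma MR_bounded:
  assumes "\<xi> \<in> MR U u z"
  obtains r where "U_ext U u (\<lambda>x. dist x z) \<xi> < ereal r"
  using assms ereal_dense2 unfolding MR_def by blast

text \<open>On \<open>M\<close> a unit ball function is dominated by the distance to
  \<open>z\<close>, and the bound passes to \<open>\<xi>\<close> through the open set where the
  extended distance is below \<open>r\<close>. It does not depend on \<open>f\<close>.\<close>

lemma U_ext_bound:
  assumes f: "f \<in> lip_ball z" and \<xi>: "\<xi> \<in> topspace U" "U_ext U u (\<lambda>x. dist x z) \<xi> < ereal r"
  shows "U_ext U u f \<xi> \<in> {ereal (- r)..ereal r}"
proof -
  have L: "1-lipschitz_on UNIV f" "f z = 0" using f by (auto simp: lip_ball_iff)
  let ?V = "{\<xi> \<in> topspace U. U_ext U u (\<lambda>x. dist x z) \<xi> \<in> {..<ereal r}}"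
  have V: "openin U ?V"
    by (rule openin_continuous_map_preimage[OF U_ext_continuous[OF lipschitz_on_dist]]) simp
  have \<xi>V: "\<xi> \<in> ?V" using \<xi> by simp
  show ?thesis
  proof (rule dense_closedin[OF U_ext_continuous[OF L(1)] u_dense V \<xi>V])
    fix x assume "u x \<in> ?V"
    then have "dist x z < r" by (simp add: U_ext_image[OF lipschitz_on_dist])
    moreover have "\<bar>f x\<bar> \<le> dist x z" using lip_ball_diff_le[OF f, of x z] L by simp
    ultimately have "\<bar>f x\<bar> \<le> r" by linarith
    then show "U_ext U u f (u x) \<in> {ereal (- r)..ereal r}"
      unfolding U_ext_image[OF L(1)] by (simp add: abs_le_iff)
  qed simp
qed

text \<open>On \<open>MR\<close> the conversion \<open>real_of_ereal\<close> in \<open>delta\<close>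
  therefore never meets an infinite value, which it would turn into 0.\<close>

lemma U_ext_finite:
  assumes "f \<in> lip_ball z" "\<xi> \<in> MR U u z"
  shows "\<bar>U_ext U u f \<xi>\<bar> \<noteq> \<infinity>"
proof -
  obtain r where "U_ext U u (\<lambda>x. dist x z) \<xi> < ereal r" using MR_bounded assms by blast
  then have "U_ext U u f \<xi> \<in> {ereal (- r)..ereal r}"
    using U_ext_bound assms by (simp add: MR_def)
  then show ?thesis by (cases "U_ext U u f \<xi>") simp_all
qed

lemma dbar_eq_SUP:
  "dbar U u z \<xi> \<eta> = (SUP f \<in> lip_ball z. \<bar>delta U u \<xi> f - delta U u \<eta> f\<bar>)"
  by (simp add: dbar_def Lip0_dual_norm_def lip_ball_def)

lemma delta_diff_le_dbar:
  assumes "\<xi> \<in> MR U u z" "\<eta> \<in> MR U u z" "f \<in> lip_ball z"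
  shows "delta U u \<xi> f - delta U u \<eta> f \<le> dbar U u z \<xi> \<eta>"
proof -
  have bound: "\<exists>r. \<forall>f\<in>lip_ball z. \<bar>delta U u \<zeta> f\<bar> \<le> r" if \<zeta>: "\<zeta> \<in> MR U u z" for \<zeta>
  proof -
    obtain r where r: "U_ext U u (\<lambda>x. dist x z) \<zeta> < ereal r" using MR_bounded[OF \<zeta>] by blast
    have "\<bar>delta U u \<zeta> f\<bar> \<le> r" if f: "f \<in> lip_ball z" for f
    proof -
      obtain t where t: "U_ext U u f \<zeta> = ereal t" using U_ext_finite[OF f \<zeta>] by auto
      then have "ereal t \<in> {ereal (- r)..ereal r}"
        using U_ext_bound[OF f _ r] \<zeta> by (simp add: MR_def)
      then show ?thesis using t by (simp add: delta_def abs_le_iff)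
    qed
    then show ?thesis by blast
  qed
  obtain r where r: "\<forall>f\<in>lip_ball z. \<bar>delta U u \<xi> f\<bar> \<le> r" using bound assms(1) by blast
  obtain s where s: "\<forall>f\<in>lip_ball z. \<bar>delta U u \<eta> f\<bar> \<le> s" using bound assms(2) by blast
  \<comment> \<open>A real supremum dominates its members only for sets bounded above; the bounds
    uniform in \<open>f\<close> provide this.\<close>
  have "bdd_above ((\<lambda>f. \<bar>delta U u \<xi> f - delta U u \<eta> f\<bar>) ` lip_ball z)"
  proof (rule bdd_aboveI2)
    fix f assume "f \<in> lip_ball z"
    then have "\<bar>delta U u \<xi> f\<bar> \<le> r" "\<bar>delta U u \<eta> f\<bar> \<le> s" using r s by blast+
    then show "\<bar>delta U u \<xi> f - delta U u \<eta> f\<bar> \<le> r + s" by linarith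
  qed
  then have "\<bar>delta U u \<xi> f - delta U u \<eta> f\<bar> \<le> dbar U u z \<xi> \<eta>"
    unfolding dbar_eq_SUP using assms by (intro cSUP_upper)
  then show ?thesis by linarith
qed

lemma dbar_least:
  "(\<And>f. f \<in> lip_ball z \<Longrightarrow> \<bar>delta U u \<xi> f - delta U u \<eta> f\<bar> \<le> c) \<Longrightarrow> dbar U u z \<xi> \<eta> \<le> c"
  unfolding dbar_eq_SUP using zero_in_lip_ball by (intro cSUP_least) auto

end

section \<open>The Stone--Cech compactification of \<open>Mtilde\<close>\<close>

context
  fixes B :: "'b topology" and b :: "'a::metric_space \<times> 'a \<Rightarrow> 'b"
  assumes sc: "stone_cech_compactification (top_of_set Mtilde) B b"
begin

lemma b_dense: "B closure_of (b ` Mtilde) = topspace B"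
  using sc by (simp add: stone_cech_compactification_def compactification_def)

lemma b_embedding: "embedding_map (top_of_set Mtilde) B b"
  using sc by (simp add: stone_cech_compactification_def compactification_def)

lemma b_in: "p \<in> Mtilde \<Longrightarrow> b p \<in> topspace B"
  using continuous_map_funspace[OF continuous_map_if_embedding_map[OF b_embedding]] by auto

lemma bounded_extends:
  assumes "continuous_on Mtilde f" "\<And>p. p \<in> Mtilde \<Longrightarrow> \<bar>f p\<bar> \<le> c"
  shows "\<exists>g. extends_along Mtilde B b euclideanreal f g"
  using sc assms unfolding stone_cech_compactification_def
  by (force simp: bounded_iff)

lemma compact_extends:
  assumes "compact_space T" "Hausdorff_space T" "continuous_map (top_of_set Mtilde) T f"
  shows "extends_along Mtilde B b T f (cont_ext Mtilde B b T f)"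
proof -
  have "\<exists>g. extends_along (topspace (top_of_set Mtilde)) B b T f g"
  proof (rule extends_along_compact[OF _ _ assms])
    show "compactification (top_of_set Mtilde) B b"
      using sc by (simp add: stone_cech_compactification_def)
  qed (use sc in \<open>simp add: stone_cech_compactification_def\<close>)
  then obtain g where "extends_along Mtilde B b T f g" by auto
  then show ?thesis by (rule extends_along_cont_ext)
qed

lemma d_ext_extends: "extends_along Mtilde B b euclidean (\<lambda>(x, y). ereal (dist x y)) (d_ext B b)"
proof -
  have "continuous_on Mtilde (\<lambda>p::'a \<times> 'a. squash (dist (fst p) (snd p)))"
    by (intro continuous_on_compose2[OF continuous_on_squash[of UNIV]] continuous_intros) auto
  then obtain g where "extends_along Mtilde B b euclideanreal (\<lambda>p. squash (dist (fst p) (snd p))) g"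
    using bounded_extends[of _ 1] abs_squash_less[THEN less_imp_le] by metis
  from extends_along_ereal[OF this] show ?thesis
    unfolding d_ext_def case_prod_unfold by (rule extends_along_cont_ext)
qed

lemma Phi_extends:
  assumes "f \<in> lip_ball z"
  shows "extends_along Mtilde B b euclideanreal (\<lambda>(x, y). (f x - f y) / dist x y) (Phi B b f)"
proof -
  have f: "continuous_on UNIV f"
    using assms lipschitz_on_continuous_on by (auto simp: lip_ball_iff)
  have "continuous_on Mtilde (\<lambda>p. (f (fst p) - f (snd p)) / dist (fst p) (snd p))"
    by (intro continuous_intros continuous_on_compose2[OF f]) (auto simp: Mtilde_def)
  moreover have "\<bar>(f (fst p) - f (snd p)) / dist (fst p) (snd p)\<bar> \<le> 1" for p
    using lip_ball_diff_le[OF assms] by (auto simp: divide_le_eq_1)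
  ultimately have "\<exists>g. extends_along Mtilde B b euclideanreal (\<lambda>p. (f (fst p) - f (snd p)) / dist (fst p) (snd p)) g"
    by (rule bounded_extends)
  then show ?thesis
    unfolding Phi_def case_prod_unfold using extends_along_cont_ext by blast
qed

lemma d_ext_continuous: "continuous_map B euclidean (d_ext B b)"
  and d_ext_image: "x \<noteq> y \<Longrightarrow> d_ext B b (b (x, y)) = ereal (dist x y)"
  using d_ext_extends by (auto simp: extends_along_def Mtilde_def)

lemma Phi_continuous: "f \<in> lip_ball z \<Longrightarrow> continuous_map B euclideanreal (Phi B b f)"
  and Phi_image: "f \<in> lip_ball z \<Longrightarrow> x \<noteq> y \<Longrightarrow> Phi B b f (b (x, y)) = (f x - f y) / dist x y"
  using Phi_extends by (auto simp: extends_along_def Mtilde_def)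

lemma abs_Phi_le_1:
  assumes f: "f \<in> lip_ball z" and "\<zeta> \<in> topspace B"
  shows "\<bar>Phi B b f \<zeta>\<bar> \<le> 1"
proof -
  have "Phi B b f \<zeta> \<in> {-1..1}"
  proof (rule dense_closedin[OF Phi_continuous[OF f] b_dense, of "topspace B"])
    fix p :: "'a \<times> 'a" assume "p \<in> Mtilde"
    then obtain x y where p: "p = (x, y)" "x \<noteq> y" by (auto simp: Mtilde_def)
    show "Phi B b f (b p) \<in> {-1..1}"
      using lip_ball_diff_le[OF f, of x y] p
      by (auto simp: Phi_image[OF f] divide_simps abs_le_iff)
  qed (use assms in auto)
  then show ?thesis by auto
qed

text \<open>Used to remove the absolute value in the dual norm. The sum of the two functions is
  continuous and vanishes on the dense copy of \<open>Mtilde\<close>.\<close>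

lemma Phi_uminus:
  assumes f: "f \<in> lip_ball z" and "\<zeta> \<in> topspace B"
  shows "Phi B b (\<lambda>x. - f x) \<zeta> = - Phi B b f \<zeta>"
proof -
  note f' = lip_ball_uminus[OF f]
  have "Phi B b (\<lambda>x. - f x) \<zeta> + Phi B b f \<zeta> \<in> {0}"
  proof (rule dense_closedin[where T = euclideanreal and V = "topspace B" and S = Mtilde])
    show "continuous_map B euclideanreal (\<lambda>\<zeta>. Phi B b (\<lambda>x. - f x) \<zeta> + Phi B b f \<zeta>)"
      using Phi_continuous[OF f] Phi_continuous[OF f'] by (intro continuous_map_add)
    fix p :: "'a \<times> 'a" assume "p \<in> Mtilde"
    then obtain x y where p: "p = (x, y)" "x \<noteq> y" by (auto simp: Mtilde_def)
    then show "Phi B b (\<lambda>x. - f x) (b p) + Phi B b f (b p) \<in> {0}"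
      by (auto simp: Phi_image[OF f] Phi_image[OF f'] divide_simps)
  qed (use assms b_dense in auto)
  then show ?thesis by simp
qed

text \<open>One neighbourhood serves the whole unit ball. Moving both points by less than
  \<open>e\<close> changes the difference of values of \<open>f\<close> by at most
  \<open>2 * e\<close> and the distance by at most \<open>2 * e\<close>, which gives the error
  \<open>4 * e\<close>.\<close>

lemma Phi_local_estimate:
  assumes xy: "x \<noteq> y" and e: "0 < e" "2 * e < dist x y"
  obtains V where "openin B V" "b (x, y) \<in> V"
    "\<And>f \<zeta>. f \<in> lip_ball z \<Longrightarrow> \<zeta> \<in> V \<Longrightarrow>
       dist x y - (f x - f y) \<le> 4 * e + (1 - Phi B b f \<zeta>) * (dist x y + 2 * e)"
proof -
  define D where "D = dist x y"
  have pos: "D + 2 * e > 0" unfolding D_def using e by (simp add: add_nonneg_pos)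
  define W where "W = Mtilde \<inter> (ball x e \<times> ball y e)"
  have "openin (top_of_set Mtilde) W"
    unfolding W_def by (intro openin_open_Int open_Times open_ball)
  then have "openin (subtopology B (b ` Mtilde)) (b ` W)"
    using b_embedding homeomorphic_map_openness_eq unfolding embedding_map_def
    by (metis topspace_euclidean_subtopology)
  \<comment> \<open>\<open>b\<close> is open only onto its image, so \<open>W\<close> has to be cut
    out by an open set of \<open>B\<close>.\<close>
  then obtain V where V: "openin B V" "b ` W = V \<inter> b ` Mtilde"
    by (auto simp: openin_subtopology)
  have inj: "inj_on b Mtilde"
    using b_embedding embedding_map_def homeomorphic_imp_injective_map by fastforce
  show thesis
  proof
    show "openin B V" by fact
    have "(x, y) \<in> W" using xy e by (simp add: W_def Mtilde_def)
    then show "b (x, y) \<in> V" using V(2) by blast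
    fix f \<zeta> assume f: "f \<in> lip_ball z" and \<zeta>: "\<zeta> \<in> V"
    \<comment> \<open>The estimate is solved for \<open>Phi\<close>, so that it becomes a closed
      condition that density carries from pairs near \<open>(x, y)\<close> to
      \<open>\<zeta>\<close>.\<close>
    have "Phi B b f \<zeta> \<in> {..1 - (D - (f x - f y) - 4 * e) / (D + 2 * e)}"
    proof (rule dense_closedin[OF Phi_continuous[OF f] b_dense V(1) \<zeta>])
      fix p assume p: "p \<in> Mtilde" "b p \<in> V"
      then obtain q where "q \<in> W" "b p = b q" using V(2) by blast
      then have "p \<in> W" using inj p by (metis IntD1 W_def inj_onD)
      then obtain x' y' where p: "p = (x', y')" "x' \<noteq> y'" "dist x x' < e" "dist y y' < e"
        by (auto simp: W_def Mtilde_def)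
      define D' where "D' = dist x' y'"
      have D': "D - 2 * e \<le> D'" "D' \<le> D + 2 * e" "D' > 0"
        unfolding D_def D'_def using p dist_triangle[of x y x'] dist_triangle[of x' y y']
          dist_triangle[of x' y' x] dist_triangle[of x y' y]
        by (auto simp: dist_commute)
      have "f x' - f y' \<le> f x - f y + 2 * e"
        using lip_ball_diff_le[OF f, of x x'] lip_ball_diff_le[OF f, of y y'] p by linarith
      moreover have Phi: "Phi B b f (b p) * D' = f x' - f y'"
        using D' unfolding p(1) Phi_image[OF f p(2)] D'_def by simp
      ultimately have "D - (f x - f y) - 4 * e \<le> (1 - Phi B b f (b p)) * D'"
        using D' by (simp add: left_diff_distrib)
      also have "\<dots> \<le> (1 - Phi B b f (b p)) * (D + 2 * e)"
        using D' abs_Phi_le_1[OF f b_in[OF \<open>p \<in> Mtilde\<close>]] by (intro mult_left_mono) auto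
      finally have "(D - (f x - f y) - 4 * e) / (D + 2 * e) \<le> 1 - Phi B b f (b p)"
        using pos_divide_le_eq[OF pos] by blast
      then show "Phi B b f (b p) \<in> {..1 - (D - (f x - f y) - 4 * e) / (D + 2 * e)}" by simp
    qed simp
    then have "(D - (f x - f y) - 4 * e) / (D + 2 * e) \<le> 1 - Phi B b f \<zeta>" by simp
    then have "D - (f x - f y) - 4 * e \<le> (1 - Phi B b f \<zeta>) * (D + 2 * e)"
      using pos_divide_le_eq[OF pos] by blast
    then show "dist x y - (f x - f y) \<le> 4 * e + (1 - Phi B b f \<zeta>) * (dist x y + 2 * e)"
      unfolding D_def by linarith
  qed
qed

end

section \<open>Cyclic monotonicity\<close>

context
  fixes z :: "'a::metric_space"
    and U :: "'u topology" and u :: "'a \<Rightarrow> 'u"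
    and B :: "'b topology" and b :: "'a \<times> 'a \<Rightarrow> 'b"
  assumes uc: "uniform_compactification U u"
    and sc: "stone_cech_compactification (top_of_set Mtilde) B b"
begin

section \<open>Coordinate maps and the set R\<close>

lemma coord_extends:
  shows fst_coord_extends: "extends_along Mtilde B b U (\<lambda>p. u (fst p)) (\<lambda>\<zeta>. fst (coord B b U u \<zeta>))"
    and snd_coord_extends: "extends_along Mtilde B b U (\<lambda>p. u (snd p)) (\<lambda>\<zeta>. snd (coord B b U u \<zeta>))"
proof -
  have "continuous_map (top_of_set Mtilde) U (\<lambda>p. u (fst p))"
    "continuous_map (top_of_set Mtilde) U (\<lambda>p. u (snd p))"
    using continuous_map_compose[OF _ u_continuous[OF uc], of "top_of_set Mtilde" fst]
      continuous_map_compose[OF _ u_continuous[OF uc], of "top_of_set Mtilde" snd]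
    by (simp_all add: o_def continuous_on_fst continuous_on_snd continuous_on_id)
  then show "extends_along Mtilde B b U (\<lambda>p. u (fst p)) (\<lambda>\<zeta>. fst (coord B b U u \<zeta>))"
    "extends_along Mtilde B b U (\<lambda>p. u (snd p)) (\<lambda>\<zeta>. snd (coord B b U u \<zeta>))"
    unfolding coord_def fst_conv snd_conv
    using compact_extends[OF sc U_compact[OF uc]] by blast+
qed

lemma coord_continuous:
  "continuous_map B U (\<lambda>\<zeta>. fst (coord B b U u \<zeta>))"
  "continuous_map B U (\<lambda>\<zeta>. snd (coord B b U u \<zeta>))"
  using coord_extends by (simp_all add: extends_along_def)

lemma coord_image: "x \<noteq> y \<Longrightarrow> coord B b U u (b (x, y)) = (u x, u y)"
  using coord_extends by (auto simp: extends_along_def Mtilde_def prod_eq_iff)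

lemma U_ext_coord_continuous:
  assumes "L-lipschitz_on UNIV f"
  shows "continuous_map B euclidean (\<lambda>\<zeta>. U_ext U u f (fst (coord B b U u \<zeta>)))"
    and "continuous_map B euclidean (\<lambda>\<zeta>. U_ext U u f (snd (coord B b U u \<zeta>)))"
  using coord_continuous[THEN continuous_map_compose, OF U_ext_continuous[OF uc assms]]
  by (simp_all add: o_def)

text \<open>The value \<open>\<infinity>\<close> of \<open>r\<close> gives R itself; finite values
  give open sets on which the extended distance is bounded.\<close>

abbreviation (input) rho_less :: "ereal \<Rightarrow> 'b set" where
  "rho_less r \<equiv> {\<zeta> \<in> topspace B. U_ext U u (\<lambda>x. dist x z) (fst (coord B b U u \<zeta>)) \<in> {..<r}} \<inter>
     {\<zeta> \<in> topspace B. U_ext U u (\<lambda>x. dist x z) (snd (coord B b U u \<zeta>)) \<in> {..<r}}"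

lemma openin_rho_less: "openin B (rho_less r)"
  by (rule openin_Int; rule openin_continuous_map_preimage[OF U_ext_coord_continuous(1)[OF lipschitz_on_dist]]
      openin_continuous_map_preimage[OF U_ext_coord_continuous(2)[OF lipschitz_on_dist]]) simp_all

lemma Rset_eq: "Rset B b U u z = rho_less \<infinity>"
  using coord_continuous[THEN continuous_map_funspace]
  by (auto simp: Rset_def MR_def mem_Times_iff)

lemma b_in_Rset: "p \<in> Mtilde \<Longrightarrow> b p \<in> Rset B b U u z"
  using b_in[OF sc] u_in_MR[OF uc] by (cases p) (auto simp: Rset_def coord_image Mtilde_def)

text \<open>Near \<open>\<zeta>\<close> both coordinates stay within a fixed distance of
  \<open>z\<close>, and the triangle inequality through \<open>z\<close> bounds the distance between
  them.\<close>

lemma d_ext_Rset: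
  assumes "\<zeta> \<in> Rset B b U u z"
  obtains r where "0 \<le> r" "d_ext B b \<zeta> = ereal r"
proof -
  have "coord B b U u \<zeta> \<in> MR U u z \<times> MR U u z" "\<zeta> \<in> topspace B"
    using assms by (auto simp: Rset_def)
  then obtain r s where
      "U_ext U u (\<lambda>x. dist x z) (fst (coord B b U u \<zeta>)) < ereal r"
      "U_ext U u (\<lambda>x. dist x z) (snd (coord B b U u \<zeta>)) < ereal s"
    using MR_bounded[OF uc] by (metis mem_Times_iff)
  then have \<zeta>: "\<zeta> \<in> rho_less (ereal (max r s))"
    using \<open>\<zeta> \<in> topspace B\<close> by (auto elim: less_le_trans)
  have "d_ext B b \<zeta> \<in> {0..ereal (2 * max r s)}"
  proof (rule dense_closedin[OF d_ext_continuous[OF sc] b_dense[OF sc] openin_rho_less \<zeta>])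
    fix p :: "'a \<times> 'a" assume p: "p \<in> Mtilde" "b p \<in> rho_less (ereal (max r s))"
    obtain x y where xy: "p = (x, y)" "x \<noteq> y" using p by (auto simp: Mtilde_def)
    have "dist x z < max r s" "dist y z < max r s"
      using p by (simp_all add: xy coord_image U_ext_image[OF uc lipschitz_on_dist] del: less_max_iff_disj ereal_max)
    then have "dist x y \<le> 2 * max r s"
      using dist_triangle2[of x y z] by linarith
    then show "d_ext B b (b p) \<in> {0..ereal (2 * max r s)}"
      by (simp add: xy d_ext_image[OF sc])
  qed simp
  then show thesis using that by (cases "d_ext B b \<zeta>") auto
qed

text \<open>For pairs in \<open>Mtilde\<close> this is the difference quotient multiplied out. On R
  all the extensions are finite, so both sides are continuous there and density applies.\<close>

lemma delta_diff_eq: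
  assumes f: "f \<in> lip_ball z" and \<zeta>: "\<zeta> \<in> Rset B b U u z"
  shows "delta U u (fst (coord B b U u \<zeta>)) f - delta U u (snd (coord B b U u \<zeta>)) f =
    Phi B b f \<zeta> * real_of_ereal (d_ext B b \<zeta>)"
proof (rule forall_in_closure_of_eq[where X = "subtopology B (Rset B b U u z)" and Y = euclideanreal
      and S = "b ` Mtilde"])
  have L: "1-lipschitz_on UNIV f" using f by (simp add: lip_ball_iff)
  have Rset: "\<zeta> \<in> topspace B" "coord B b U u \<zeta> \<in> MR U u z \<times> MR U u z"
    if "\<zeta> \<in> Rset B b U u z" for \<zeta> using that by (auto simp: Rset_def)
  \<comment> \<open>The copy of \<open>Mtilde\<close> lies inside R, so its density in
    \<open>B\<close> gives density in the subspace R.\<close>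
  show "\<zeta> \<in> subtopology B (Rset B b U u z) closure_of b ` Mtilde"
    using b_in_Rset \<zeta> Rset(1) b_dense[OF sc]
    by (subst closure_of_subtopology_open) auto
  have "continuous_map (subtopology B (Rset B b U u z)) euclideanreal
        (\<lambda>\<zeta>. delta U u (fst (coord B b U u \<zeta>)) f)"
    "continuous_map (subtopology B (Rset B b U u z)) euclideanreal
        (\<lambda>\<zeta>. delta U u (snd (coord B b U u \<zeta>)) f)"
    unfolding delta_def
    by (rule continuous_map_real_of_ereal,
        rule continuous_map_from_subtopology[OF U_ext_coord_continuous(1)[OF L]]
          continuous_map_from_subtopology[OF U_ext_coord_continuous(2)[OF L]],
        rule U_ext_finite[OF uc f], use Rset(2) in \<open>auto simp: mem_Times_iff\<close>)+
  then show "continuous_map (subtopology B (Rset B b U u z)) euclideanreal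
      (\<lambda>\<zeta>. delta U u (fst (coord B b U u \<zeta>)) f - delta U u (snd (coord B b U u \<zeta>)) f)"
    by (rule continuous_map_diff)
  have "continuous_map (subtopology B (Rset B b U u z)) euclideanreal (\<lambda>\<zeta>. real_of_ereal (d_ext B b \<zeta>))"
  proof (rule continuous_map_real_of_ereal)
    fix \<zeta> assume "\<zeta> \<in> topspace (subtopology B (Rset B b U u z))"
    then obtain r where "d_ext B b \<zeta> = ereal r" using d_ext_Rset by auto
    then show "\<bar>d_ext B b \<zeta>\<bar> \<noteq> \<infinity>" by simp
  qed (rule continuous_map_from_subtopology[OF d_ext_continuous[OF sc]])
  then show "continuous_map (subtopology B (Rset B b U u z)) euclideanreal
      (\<lambda>\<zeta>. Phi B b f \<zeta> * real_of_ereal (d_ext B b \<zeta>))"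
    by (intro continuous_map_real_mult continuous_map_from_subtopology[OF Phi_continuous[OF sc f]])
  fix \<zeta> assume "\<zeta> \<in> b ` Mtilde"
  then obtain x y where "\<zeta> = b (x, y)" "x \<noteq> y" by (auto simp: Mtilde_def)
  then show "delta U u (fst (coord B b U u \<zeta>)) f - delta U u (snd (coord B b U u \<zeta>)) f =
    Phi B b f \<zeta> * real_of_ereal (d_ext B b \<zeta>)"
    by (simp add: coord_image delta_def U_ext_image[OF uc L] Phi_image[OF sc f] d_ext_image[OF sc])
qed simp

text \<open>With \<open>r\<close> the extended distance at \<open>\<zeta>\<close>, every unit ball
  function has difference \<open>Phi B b g \<zeta> * r\<close>, of absolute value at most
  \<open>r\<close>; along \<open>f n\<close> these differences tend to \<open>r\<close>, so the
  supremum is \<open>r\<close>.\<close>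

lemma dbar_coord_eq:
  assumes f: "\<And>n::nat. f n \<in> lip_ball z" and \<zeta>: "\<zeta> \<in> Rset B b U u z"
    and lim: "(\<lambda>n. Phi B b (f n) \<zeta>) \<longlonglongrightarrow> 1"
    and coord: "coord B b U u \<zeta> = (\<xi>, \<eta>)"
  shows "d_ext B b \<zeta> = ereal (dbar U u z \<xi> \<eta>)"
    and "(\<lambda>n. delta U u \<xi> (f n) - delta U u \<eta> (f n)) \<longlonglongrightarrow> dbar U u z \<xi> \<eta>"
proof -
  obtain r where r: "0 \<le> r" "d_ext B b \<zeta> = ereal r" using d_ext_Rset \<zeta> by blast
  have MR: "\<xi> \<in> MR U u z" "\<eta> \<in> MR U u z" and top: "\<zeta> \<in> topspace B"
    using \<zeta> coord by (auto simp: Rset_def)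
  have eq: "delta U u \<xi> g - delta U u \<eta> g = Phi B b g \<zeta> * r" if "g \<in> lip_ball z" for g
    using delta_diff_eq[OF that \<zeta>] by (simp add: coord r)
  have "(\<lambda>n. Phi B b (f n) \<zeta> * r) \<longlonglongrightarrow> 1 * r" by (intro tendsto_intros lim)
  then have lim': "(\<lambda>n. delta U u \<xi> (f n) - delta U u \<eta> (f n)) \<longlonglongrightarrow> r"
    using eq f by simp
  have "dbar U u z \<xi> \<eta> \<le> r"
  proof (rule dbar_least[OF uc])
    fix g assume g: "g \<in> lip_ball z"
    have "\<bar>Phi B b g \<zeta>\<bar> * r \<le> 1 * r"
      using abs_Phi_le_1[OF sc g top] r by (intro mult_right_mono) auto
    then show "\<bar>delta U u \<xi> g - delta U u \<eta> g\<bar> \<le> r"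
      using r by (simp add: eq[OF g] abs_mult)
  qed
  moreover have "r \<le> dbar U u z \<xi> \<eta>"
    using LIMSEQ_le_const2[OF lim'] delta_diff_le_dbar[OF uc MR f] by blast
  ultimately have "r = dbar U u z \<xi> \<eta>" by simp
  then show "d_ext B b \<zeta> = ereal (dbar U u z \<xi> \<eta>)"
    "(\<lambda>n. delta U u \<xi> (f n) - delta U u \<eta> (f n)) \<longlonglongrightarrow> dbar U u z \<xi> \<eta>"
    using r lim' by auto
qed

text \<open>The sum of \<open>f m\<close> over the second coordinates is invariant under
  permutation. Each permuted cost thus dominates the sum of the differences of \<open>f m\<close>,
  and these sums tend to the unpermuted cost.\<close>

lemma cyclically_monotonic_if_Phi_tendsto_1:
  assumes f: "\<And>n::nat. f n \<in> lip_ball z" and C: "C \<subseteq> Rset B b U u z"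
    and lim: "\<And>\<zeta>. \<zeta> \<in> C \<Longrightarrow> (\<lambda>n. Phi B b (f n) \<zeta>) \<longlonglongrightarrow> 1"
  shows "dbar_cyclically_monotonic U u z (coord B b U u ` C)"
  unfolding dbar_cyclically_monotonic_def
proof (intro conjI allI impI)
  show sub: "coord B b U u ` C \<subseteq> MR U u z \<times> MR U u z" using C by (auto simp: Rset_def)
  fix n :: nat and \<xi> \<eta> \<sigma>
  assume *: "(\<forall>k\<in>{1..n}. (\<xi> k, \<eta> k) \<in> coord B b U u ` C) \<and> \<sigma> permutes {1..n}"
  then have \<sigma>: "\<sigma> permutes {1..n}" by blast
  have MR: "\<xi> k \<in> MR U u z" "\<eta> k \<in> MR U u z" if "k \<in> {1..n}" for k
    using * sub that by blast+
  have "(\<lambda>m. delta U u (\<xi> k) (f m) - delta U u (\<eta> k) (f m)) \<longlonglongrightarrow> dbar U u z (\<xi> k) (\<eta> k)"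
    if k: "k \<in> {1..n}" for k
  proof -
    have "(\<xi> k, \<eta> k) \<in> coord B b U u ` C" using * k by blast
    then obtain \<zeta> where \<zeta>: "\<zeta> \<in> C" "coord B b U u \<zeta> = (\<xi> k, \<eta> k)" by (metis imageE)
    show ?thesis using dbar_coord_eq(2)[OF f subsetD[OF C \<zeta>(1)] lim[OF \<zeta>(1)] \<zeta>(2)] .
  qed
  then have "(\<lambda>m. \<Sum>k=1..n. delta U u (\<xi> k) (f m) - delta U u (\<eta> k) (f m))
      \<longlonglongrightarrow> (\<Sum>k=1..n. dbar U u z (\<xi> k) (\<eta> k))"
    by (intro tendsto_sum)
  moreover have "(\<Sum>k=1..n. delta U u (\<xi> k) (f m) - delta U u (\<eta> k) (f m)) \<le>
      (\<Sum>k=1..n. dbar U u z (\<xi> k) (\<eta> (\<sigma> k)))" for m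
  proof -
    have "(\<Sum>k=1..n. delta U u (\<eta> k) (f m)) = (\<Sum>k=1..n. delta U u (\<eta> (\<sigma> k)) (f m))"
      using sum.permute[OF \<sigma>, of "\<lambda>k. delta U u (\<eta> k) (f m)"] by (simp add: o_def)
    then have "(\<Sum>k=1..n. delta U u (\<xi> k) (f m) - delta U u (\<eta> k) (f m)) =
        (\<Sum>k=1..n. delta U u (\<xi> k) (f m) - delta U u (\<eta> (\<sigma> k)) (f m))"
      by (simp add: sum_subtractf)
    also have "\<dots> \<le> (\<Sum>k=1..n. dbar U u z (\<xi> k) (\<eta> (\<sigma> k)))"
    proof (rule sum_mono)
      fix k assume k: "k \<in> {1..n}"
      then have "\<sigma> k \<in> {1..n}" using permutes_in_image[OF \<sigma>] by blast
      then show "delta U u (\<xi> k) (f m) - delta U u (\<eta> (\<sigma> k)) (f m) \<le> dbar U u z (\<xi> k) (\<eta> (\<sigma> k))"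
        using delta_diff_le_dbar[OF uc MR(1)[OF k] MR(2) f] by blast
    qed
    finally show ?thesis .
  qed
  ultimately show "(\<Sum>k=1..n. dbar U u z (\<xi> k) (\<eta> k)) \<le> (\<Sum>k=1..n. dbar U u z (\<xi> k) (\<eta> (\<sigma> k)))"
    by (intro LIMSEQ_le_const2) auto
qed

end

section \<open>Maximizing sequences\<close>

context
  fixes z :: "'a::metric_space"
    and B :: "'b topology" and b :: "'a \<times> 'a \<Rightarrow> 'b" and \<mu> :: "'b measure"
  assumes sc: "stone_cech_compactification (top_of_set Mtilde) B b"
    and mu: "\<mu> \<in> M_op B b z"
begin

lemma radon_facts:
  shows mu_finite: "finite_measure \<mu>" and mu_space: "space \<mu> = topspace B"
    and mu_open: "openin B V \<Longrightarrow> V \<in> sets \<mu>"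
  using mu by (auto simp: M_op_def radon_measure_def intro: sigma_sets.Basic)

lemma Phi_measurable:
  assumes "f \<in> lip_ball z"
  shows "Phi B b f \<in> borel_measurable \<mu>"
proof (rule borel_measurableI)
  fix S :: "real set" assume "open S"
  then have "openin B {\<zeta> \<in> topspace B. Phi B b f \<zeta> \<in> S}"
    using openin_continuous_map_preimage[OF Phi_continuous[OF sc assms]] by simp
  moreover have "{\<zeta> \<in> topspace B. Phi B b f \<zeta> \<in> S} = Phi B b f -` S \<inter> space \<mu>"
    using mu_space by auto
  ultimately show "Phi B b f -` S \<inter> space \<mu> \<in> sets \<mu>" using mu_open by metis
qed

lemma Phi_integrable:
  assumes "f \<in> lip_ball z"
  shows "integrable \<mu> (Phi B b f)"
  using finite_measure.integrable_const_bound[OF mu_finite _ Phi_measurable[OF assms], of 1]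
    abs_Phi_le_1[OF sc assms] mu_space by (auto intro!: AE_I2)

text \<open>The dual norm gives a function whose integral is nearly maximal in absolute value;
  replacing it by its negative if necessary fixes the sign.\<close>

lemma near_maximizer:
  assumes "0 < e"
  obtains f where "f \<in> lip_ball z" "measure \<mu> (space \<mu>) - e < (\<integral>\<zeta>. Phi B b f \<zeta> \<partial>\<mu>)"
proof -
  have "measure \<mu> (space \<mu>) - e < (SUP f \<in> lip_ball z. \<bar>Phi_adjoint B b \<mu> f\<bar>)"
    using mu assms by (simp add: M_op_def Lip0_dual_norm_def lip_ball_def)
  then obtain f where f: "f \<in> lip_ball z" "measure \<mu> (space \<mu>) - e < \<bar>Phi_adjoint B b \<mu> f\<bar>"
    using less_cSupD zero_in_lip_ball by (metis (no_types, lifting) empty_iff imageE image_is_empty)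
  have "Phi_adjoint B b \<mu> (\<lambda>x. - f x) = - Phi_adjoint B b \<mu> f"
  proof -
    have "(\<integral>\<zeta>. Phi B b (\<lambda>x. - f x) \<zeta> \<partial>\<mu>) = (\<integral>\<zeta>. - Phi B b f \<zeta> \<partial>\<mu>)"
      using Phi_uminus[OF sc f(1)] mu_space by (intro Bochner_Integration.integral_cong) auto
    then show ?thesis by (simp add: Phi_adjoint_def)
  qed
  then show thesis
    using that[OF f(1)] that[OF lip_ball_uminus[OF f(1)]] f(2)
    unfolding Phi_adjoint_def by (metis abs_real_def)
qed

lemma maximizing_sequence:
  obtains f where "\<And>n::nat. f n \<in> lip_ball z" "AE \<zeta> in \<mu>. (\<lambda>n. Phi B b (f n) \<zeta>) \<longlonglongrightarrow> 1"
proof -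
  interpret finite_measure \<mu> by (rule mu_finite)
  have "\<exists>f\<in>lip_ball z. measure \<mu> (space \<mu>) - inverse (real (Suc n)) < (\<integral>\<zeta>. Phi B b f \<zeta> \<partial>\<mu>)" for n
    using near_maximizer[of "inverse (real (Suc n))"] by (metis inverse_positive_iff_positive of_nat_0_less_iff zero_less_Suc)
  then obtain f where f: "\<And>n. f n \<in> lip_ball z"
    and less: "\<And>n. measure \<mu> (space \<mu>) - inverse (real (Suc n)) < (\<integral>\<zeta>. Phi B b (f n) \<zeta> \<partial>\<mu>)"
    by metis
  have int: "integrable \<mu> (\<lambda>\<zeta>. 1 - Phi B b (f n) \<zeta>)" for n
    using Phi_integrable[OF f] by (intro Bochner_Integration.integrable_diff) auto
  \<comment> \<open>Since \<open>Phi\<close> is at most 1, the gap to the total mass is an L1 norm,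
    and L1 convergence yields a subsequence converging almost everywhere.\<close>
  have norm: "(\<integral>\<zeta>. norm (1 - Phi B b (f n) \<zeta>) \<partial>\<mu>) = measure \<mu> (space \<mu>) - (\<integral>\<zeta>. Phi B b (f n) \<zeta> \<partial>\<mu>)" for n
  proof -
    have "norm (1 - Phi B b (f n) \<zeta>) = 1 - Phi B b (f n) \<zeta>" if "\<zeta> \<in> space \<mu>" for \<zeta>
      using abs_Phi_le_1[OF sc f, of \<zeta> n] that mu_space by simp
    then have "(\<integral>\<zeta>. norm (1 - Phi B b (f n) \<zeta>) \<partial>\<mu>) = (\<integral>\<zeta>. 1 - Phi B b (f n) \<zeta> \<partial>\<mu>)"
      by (intro Bochner_Integration.integral_cong) auto
    also have "\<dots> = measure \<mu> (space \<mu>) - (\<integral>\<zeta>. Phi B b (f n) \<zeta> \<partial>\<mu>)"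
      using Phi_integrable[OF f] by (subst Bochner_Integration.integral_diff) auto
    finally show ?thesis .
  qed
  have "(\<lambda>n. \<integral>\<zeta>. norm (1 - Phi B b (f n) \<zeta>) \<partial>\<mu>) \<longlonglongrightarrow> 0"
  proof (rule tendsto_sandwich[OF _ _ tendsto_const LIMSEQ_inverse_real_of_nat])
    show "\<forall>\<^sub>F n in sequentially. 0 \<le> (\<integral>\<zeta>. norm (1 - Phi B b (f n) \<zeta>) \<partial>\<mu>)" by simp
    show "\<forall>\<^sub>F n in sequentially. (\<integral>\<zeta>. norm (1 - Phi B b (f n) \<zeta>) \<partial>\<mu>) \<le> inverse (real (Suc n))"
      unfolding norm using less by (intro always_eventually allI) (metis diff_less_eq less_diff_eq add.commute less_imp_le)
  qed
  from tendsto_L1_AE_subseq[OF int this] obtain r :: "nat \<Rightarrow> nat"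
    where ae: "AE \<zeta> in \<mu>. (\<lambda>n. 1 - Phi B b (f (r n)) \<zeta>) \<longlonglongrightarrow> 0" by blast
  have "AE \<zeta> in \<mu>. (\<lambda>n. Phi B b (f (r n)) \<zeta>) \<longlonglongrightarrow> 1"
    using ae
  proof (rule AE_mp, intro AE_I2 impI)
    fix \<zeta> assume "(\<lambda>n. 1 - Phi B b (f (r n)) \<zeta>) \<longlonglongrightarrow> 0"
    from tendsto_diff[OF tendsto_const[of 1] this]
    show "(\<lambda>n. Phi B b (f (r n)) \<zeta>) \<longlonglongrightarrow> 1" by simp
  qed
  then show thesis using f by (intro that[of "\<lambda>n. f (r n)"])
qed

text \<open>The complement is a union of possibly uncountably many null open sets; it is measurable
  because it is open.\<close>

lemma supp_measurable: "supp B \<mu> \<in> sets \<mu>"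
proof -
  have eq: "supp B \<mu> = topspace B - \<Union> {V. openin B V \<and> emeasure \<mu> V = 0}"
    by (auto simp: supp_def zero_less_iff_neq_zero)
  have "openin B (\<Union> {V. openin B V \<and> emeasure \<mu> V = 0})" by (rule openin_Union) simp
  then show ?thesis unfolding eq mu_space[symmetric] by (intro sets.compl_sets mu_open)
qed

lemma Phi_tendsto_1_on_supp_Mtilde:
  assumes f: "\<And>n::nat. f n \<in> lip_ball z"
    and ae: "AE \<zeta> in \<mu>. (\<lambda>n. Phi B b (f n) \<zeta>) \<longlonglongrightarrow> 1"
    and xy: "x \<noteq> y" and supp: "b (x, y) \<in> supp B \<mu>"
  shows "(\<lambda>n. Phi B b (f n) (b (x, y))) \<longlonglongrightarrow> 1"
proof -
  define D where "D = dist x y"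
  have "D > 0" using xy by (simp add: D_def)
  have "(\<lambda>n. f n x - f n y) \<longlonglongrightarrow> D"
  proof (rule LIMSEQ_I)
    fix c :: real assume "0 < c"
    \<comment> \<open>The bound \<open>D / 4\<close> ensures \<open>2 * e < D\<close>;
      \<open>c / 8\<close> spends half of the error \<open>c\<close> on \<open>4 * e\<close> and
      leaves half for the term with \<open>Phi\<close>.\<close>
    define e where "e = min (D / 4) (c / 8)"
    have e: "0 < e" "2 * e < dist x y" "4 * e \<le> c / 2"
      using \<open>0 < c\<close> \<open>D > 0\<close> unfolding e_def D_def[symmetric] by auto
    obtain V where V: "openin B V" "b (x, y) \<in> V"
      and est: "\<And>g \<zeta>. g \<in> lip_ball z \<Longrightarrow> \<zeta> \<in> V \<Longrightarrow>
        D - (g x - g y) \<le> 4 * e + (1 - Phi B b g \<zeta>) * (D + 2 * e)"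
      using Phi_local_estimate[OF sc xy e(1,2)] unfolding D_def by blast
    have "emeasure \<mu> V > 0" using supp V unfolding supp_def by blast
    \<comment> \<open>\<open>V\<close> has positive measure, so almost everywhere convergence cannot
      fail at all of its points.\<close>
    obtain \<zeta> where \<zeta>: "\<zeta> \<in> V" "(\<lambda>n. Phi B b (f n) \<zeta>) \<longlonglongrightarrow> 1"
    proof (rule ccontr)
      assume "\<not> thesis"
      then have "AE \<zeta> in \<mu>. \<zeta> \<notin> V" using ae that by (auto elim!: AE_mp)
      then have "emeasure \<mu> V = 0"
        using AE_iff_measurable[OF mu_open[OF V(1)], of "\<lambda>\<zeta>. \<zeta> \<notin> V"] mu_open[OF V(1)] sets.sets_into_space
        by blast
      then show False using \<open>emeasure \<mu> V > 0\<close> by simp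
    qed
    have "(\<lambda>n. (1 - Phi B b (f n) \<zeta>) * (D + 2 * e)) \<longlonglongrightarrow> (1 - 1) * (D + 2 * e)"
      by (intro tendsto_intros \<zeta>)
    then have "\<forall>\<^sub>F n in sequentially. (1 - Phi B b (f n) \<zeta>) * (D + 2 * e) < c / 2"
      using \<open>0 < c\<close> by (intro order_tendstoD(2)[of _ 0]) auto
    then obtain n0 where n0: "\<And>n. n \<ge> n0 \<Longrightarrow> (1 - Phi B b (f n) \<zeta>) * (D + 2 * e) < c / 2"
      by (auto simp: eventually_sequentially)
    \<comment> \<open>The local estimate bounds the difference from below, the Lipschitz condition
      bounds it above by \<open>D\<close>.\<close>
    have "norm (f n x - f n y - D) < c" if "n \<ge> n0" for n
      using n0[OF that] est[OF f \<zeta>(1), of n] e(3) lip_ball_diff_le[OF f, of n x y]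
      unfolding D_def[symmetric] real_norm_def by linarith
    then show "\<exists>n0. \<forall>n\<ge>n0. norm (f n x - f n y - D) < c" by blast
  qed
  then have "(\<lambda>n. (f n x - f n y) / D) \<longlonglongrightarrow> D / D"
    using \<open>D > 0\<close> by (intro tendsto_intros) auto
  then show ?thesis using \<open>D > 0\<close> by (simp add: Phi_image[OF sc f xy] D_def)
qed

end

section \<open>The exceptional null set and the conclusion on its complement in the support\<close>

theorem theorem4p9:
  fixes z :: "'a::complete_space"
    and U :: "'u topology" and u :: "'a \<Rightarrow> 'u"
    and B :: "'b topology" and b :: "'a \<times> 'a \<Rightarrow> 'b"
    and \<mu> :: "'b measure"
  assumes "uniform_compactification U u"
    and "stone_cech_compactification (top_of_set Mtilde) B b"
    and "\<mu> \<in> M_op B b z"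
  shows "\<exists>N. N \<in> null_sets \<mu> \<and> N \<subseteq> supp B \<mu> - b ` Mtilde \<and>
    (let C = Rset B b U u z \<inter> supp B \<mu> - N in
       dbar_cyclically_monotonic U u z (coord B b U u ` C) \<and>
       (\<forall>\<zeta>\<in>C. ereal (case_prod (dbar U u z) (coord B b U u \<zeta>)) = d_ext B b \<zeta>))"
proof -
  note uc = assms(1) and sc = assms(2) and mu = assms(3)
  obtain f where f: "\<And>n::nat. f n \<in> lip_ball z"
    and ae: "AE \<zeta> in \<mu>. (\<lambda>n. Phi B b (f n) \<zeta>) \<longlonglongrightarrow> 1"
    using maximizing_sequence[OF sc mu] by blast
  define E where "E = {\<zeta> \<in> space \<mu>. \<not> (\<lambda>n. Phi B b (f n) \<zeta>) \<longlonglongrightarrow> 1}"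
  \<comment> \<open>Removing \<open>N\<close> from the support removes exactly its points where
    \<open>Phi B b (f n)\<close> fails to tend to 1.\<close>
  define N where "N = E \<inter> supp B \<mu>"
  note [measurable] = Phi_measurable[OF sc mu f]
  have "E \<in> sets \<mu>" unfolding E_def by measurable
  then have "E \<in> null_sets \<mu>"
    using ae AE_iff_null[of \<mu> "\<lambda>\<zeta>. (\<lambda>n. Phi B b (f n) \<zeta>) \<longlonglongrightarrow> 1"] by (simp add: E_def)
  then have "N \<in> null_sets \<mu>"
    unfolding N_def using supp_measurable[OF sc mu] by (rule null_set_Int2)
  moreover have "N \<subseteq> supp B \<mu> - b ` Mtilde"
    using Phi_tendsto_1_on_supp_Mtilde[OF sc mu f ae] by (auto simp: N_def E_def Mtilde_def)
  moreover define C where "C = Rset B b U u z \<inter> supp B \<mu> - N"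
  have C: "C \<subseteq> Rset B b U u z" by (auto simp: C_def)
  have lim: "(\<lambda>n. Phi B b (f n) \<zeta>) \<longlonglongrightarrow> 1" if "\<zeta> \<in> C" for \<zeta>
    using that mu_space[OF sc mu] by (auto simp: C_def N_def E_def supp_def)
  have "dbar_cyclically_monotonic U u z (coord B b U u ` C)"
    using cyclically_monotonic_if_Phi_tendsto_1[OF uc sc f C lim] .
  moreover have "\<forall>\<zeta>\<in>C. ereal (case_prod (dbar U u z) (coord B b U u \<zeta>)) = d_ext B b \<zeta>"
    using dbar_coord_eq(1)[OF uc sc f _ lim] C by (auto simp: subset_iff split: prod.split)
  ultimately show ?thesis unfolding C_def Let_def by blast
qed

end
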